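(* For any integer $b>4$ such that $b\equiv 0$ or $2 \pmod 3$, there exists an $a\in\mathbb{Z}$ such that the matrices $$V=\begin{pmatrix}a & b\\ b+1 & 0\end{pmatrix}\quad\text{and}\quad V'=\begin{pmatrix}a+1 & b\\ b+1 & 0\end{pmatrix}$$ are $S$-equivalent.
   Context: A Seifert matrix is an integral square matrix $V$ with $\det(V-V^T)=1$. Two Seifert matrices are $S$-equivalent if they are related by a finite sequence of the following moves or their inverses: (i) replacing $V$ by $PVP^T$ with $P$ an integral unimodular matrix; (ii) column expansion: replacing an $n\times n$ Seifert matrix $V$ by the $(n+2)\times(n+2)$ matrix $$\left(\begin{array}{ccc|cc} & & & 0 & 0\\ & V & & \vdots & \vdots\\ & & & 0 & 0\\ \hline u_1&\cdots&u_n&0&0\\ 0&\cdots&0&1&0\end{array}\right)$$ with $u_1,\dots,u_n\in\mathbb{Z}$; (iii) row expansion, defined analogously with the roles of rows and columns reversed ($W$ is a row expansion of $V$ if and only if $W^T$ is a column expansion of $V^T$). *)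

theory Defs
  imports "Jordan_Normal_Form.Determinant"
begin

definition seifert_matrix :: "int mat \<Rightarrow> bool" where
  "seifert_matrix V \<longleftrightarrow> square_mat V \<and> det (V - V\<^sup>T) = 1"

definition column_expansion :: "int mat \<Rightarrow> int vec \<Rightarrow> int mat" where
  "column_expansion V u =
     (let n = dim_row V in
      four_block_mat
        V                            (0\<^sub>m n 2)
        (mat_of_rows n [u, 0\<^sub>v n])  (mat_of_rows_list 2 [[0, 0], [1, 0]]))"

definition row_expansion :: "int mat \<Rightarrow> int vec \<Rightarrow> int mat" where
  "row_expansion V u = (column_expansion (V\<^sup>T) u)\<^sup>T"

inductive S_move :: "int mat \<Rightarrow> int mat \<Rightarrow> bool" where
  congruence:
    "\<lbrakk>seifert_matrix V; V \<in> carrier_mat n n; P \<in> carrier_mat n n; \<bar>det P\<bar> = 1\<rbrakk>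
      \<Longrightarrow> S_move V (P * V * P\<^sup>T)"
| column:
    "\<lbrakk>seifert_matrix V; u \<in> carrier_vec (dim_row V)\<rbrakk> \<Longrightarrow> S_move V (column_expansion V u)"
| row:
    "\<lbrakk>seifert_matrix V; u \<in> carrier_vec (dim_row V)\<rbrakk> \<Longrightarrow> S_move V (row_expansion V u)"

(* equivclp is reflexive on all matrices, so both ends are required to be Seifert matrices. *)
definition S_equivalent :: "int mat \<Rightarrow> int mat \<Rightarrow> bool" where
  "S_equivalent V W \<longleftrightarrow> seifert_matrix V \<and> seifert_matrix W \<and> equivclp S_move V W"

end

theory Submission
  imports Defs
begin

text \<open>
  Write \<open>V\<^sub>a\<close> for the matrix with rows \<open>(a, b)\<close> and \<open>(b + 1, 0)\<close>. Rationally, replacing the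
  basis \<open>e\<^sub>1, e\<^sub>2\<close> by \<open>(b + 1) e\<^sub>1, e\<^sub>2 / (b + 1)\<close> turns \<open>V\<^sub>a\<close> into \<open>V\<^sub>c\<close> with \<open>c = (b + 1)\<^sup>2 a\<close>.
  This change of lattice is realised by S-equivalence: the column expansion of \<open>V\<^sub>a\<close> by
  \<open>(-1, 0)\<close> has left kernel spanned by \<open>(0, 1, b + 1, 0)\<close>, and reducing along this vector
  exhibits it as a row expansion of \<open>V\<^sub>c\<close>. An integral shear changes \<open>a\<close> by any multiple of
  \<open>2b + 1\<close>. Modulo \<open>2b + 1\<close> we have \<open>(b + 1)\<^sup>2 = 1/4\<close>, so \<open>V\<^sub>a\<close> and \<open>V\<^sub>a\<^sub>+\<^sub>1\<close> are related as soon as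
  \<open>3a = -4\<close> modulo \<open>2b + 1\<close>, which is solvable because 3 does not divide \<open>2b + 1\<close>.
\<close>

text \<open>The conditional lets the simplifier skip the minors of vanishing entries.\<close>

lemma det_mat_Suc:
  fixes f :: "nat \<times> nat \<Rightarrow> 'a :: comm_ring_1"
  shows "det (mat (Suc n) (Suc n) f) =
    (\<Sum>j<Suc n. if f (0, j) = 0 then 0 else f (0, j) * ((-1) ^ j *
       det (mat n n (\<lambda>(i, k). f (Suc i, if k < j then k else Suc k)))))"
proof -
  let ?A = "mat (Suc n) (Suc n) f"
  have "mat_delete ?A 0 j = mat n n (\<lambda>(i, k). f (Suc i, if k < j then k else Suc k))" for j
    by (rule eq_matI) (auto simp: mat_delete_def)
  then show ?thesis
    by (subst laplace_expansion_row[of ?A "Suc n" 0])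
      (auto simp: cofactor_def intro!: sum.cong)
qed

lemma det_mat_0: "det (mat 0 0 f) = 1"
  by (rule det_dim_zero) simp

definition twist_matrix :: "int \<Rightarrow> int \<Rightarrow> int mat" where
  "twist_matrix a b = mat_of_rows_list 2 [[a, b], [b + 1, 0]]"

definition twist_expansion :: "int \<Rightarrow> int \<Rightarrow> int mat" where
  "twist_expansion a b =
     mat_of_rows_list 4 [[a, b, 0, 0], [b + 1, 0, 0, 0], [-1, 0, 0, 0], [0, 0, 1, 0]]"

text \<open>
  The last row spans the left kernel of the column expansion. The first two rows lift
  \<open>(b + 1) e\<^sub>1\<close> and \<open>e\<^sub>2 / (b + 1)\<close> to its orthogonal complement for the skew form, and the third
  is dual to the kernel vector.
\<close>

definition base_change :: "int \<Rightarrow> int \<Rightarrow> int mat" where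
  "base_change a b = mat_of_rows_list 4
     [[b + 1, 0, 0, -b], [0, 1, b, 0], [-1, a, a * b, 1], [0, 1, b + 1, 0]]"

lemma mat_of_rows_list_carrierI:
  "length rs = m \<Longrightarrow> mat_of_rows_list n rs \<in> carrier_mat m n"
  by (auto simp: mat_of_rows_list_def)

lemma twist_matrix_carrier: "twist_matrix a b \<in> carrier_mat 2 2"
  unfolding twist_matrix_def by (rule mat_of_rows_list_carrierI) simp

lemma twist_expansion_carrier: "twist_expansion a b \<in> carrier_mat 4 4"
  unfolding twist_expansion_def by (rule mat_of_rows_list_carrierI) simp

lemma base_change_carrier: "base_change a b \<in> carrier_mat 4 4"
  unfolding base_change_def by (rule mat_of_rows_list_carrierI) simp

lemma mat_minus_transpose:
  "mat n n f - (mat n n f)\<^sup>T = mat n n (\<lambda>(i, j). f (i, j) - f (j, i))"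
  by (rule eq_matI) auto

lemma seifert_twist_matrix: "seifert_matrix (twist_matrix a b)"
  by (simp add: seifert_matrix_def twist_matrix_def mat_of_rows_list_def mat_minus_transpose
      numeral_eq_Suc det_mat_Suc det_mat_0)

lemma column_expansion_twist_matrix:
  "column_expansion (twist_matrix a b) (vec_of_list [-1, 0]) = twist_expansion a b"
  by (rule eq_matI)
    (auto simp: column_expansion_def twist_matrix_def twist_expansion_def Let_def
      mat_of_rows_list_def mat_of_rows_def less_Suc_eq numeral_eq_Suc)

lemma row_expansion_twist_matrix:
  "row_expansion (twist_matrix a b) (vec_of_list [x, y]) =
   mat_of_rows_list 4 [[a, b, x, 0], [b + 1, 0, y, 0], [0, 0, 0, 1], [0, 0, 0, 0]]"
  by (rule eq_matI)
    (auto simp: row_expansion_def column_expansion_def twist_matrix_def Let_def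
      mat_of_rows_list_def mat_of_rows_def less_Suc_eq numeral_eq_Suc)

lemma seifert_twist_expansion: "seifert_matrix (twist_expansion a b)"
  by (simp add: seifert_matrix_def twist_expansion_def mat_of_rows_list_def mat_minus_transpose
      numeral_eq_Suc det_mat_Suc det_mat_0)

lemma det_base_change: "\<bar>det (base_change a b)\<bar> = 1"
proof -
  \<comment> \<open>\<open>?Q\<close> is an explicit integral inverse, so the determinant is a unit
    of the integers.\<close>
  let ?Q = "mat_of_rows_list 4
    [[1, -a * b, b, 0], [0, b + 1, 0, -b], [0, -1, 0, 1], [1, -a * (b + 1), b + 1, 0]]"
  have "?Q * base_change a b = 1\<^sub>m 4"
    by (rule eq_matI, simp_all add: base_change_def mat_of_rows_list_def
        less_Suc_eq numeral_eq_Suc scalar_prod_def)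
      (elim disjE; hypsubst_thin; simp add: algebra_simps)
  moreover have "det (?Q * base_change a b) = det ?Q * det (base_change a b)"
    by (rule det_mult[OF mat_of_rows_list_carrierI base_change_carrier]) simp
  ultimately have "det ?Q * det (base_change a b) = 1"
    by (simp only: det_one)
  then have "det (base_change a b) dvd 1"
    by (metis dvd_triv_right)
  then show ?thesis by simp
qed

text \<open>The kernel vector gives the zero last row; the third basis vector pairs on the left only
  with it, giving \<open>(0, 0, 0, 1)\<close>.\<close>

lemma base_change_twist_expansion:
  "base_change a b * twist_expansion a b * (base_change a b)\<^sup>T =
   row_expansion (twist_matrix ((b + 1)\<^sup>2 * a) b) (vec_of_list [-a, -1])"
proof -
  have "base_change a b * twist_expansion a b = mat_of_rows_list 4
      [[(b + 1) * a, (b + 1) * b, -b, 0], [1, 0, 0, 0], [0, -b, 1, 0], [0, 0, 0, 0]]"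
    by (rule eq_matI, simp_all add: base_change_def twist_expansion_def mat_of_rows_list_def
        less_Suc_eq numeral_eq_Suc scalar_prod_def)
      (elim disjE; hypsubst_thin; simp add: algebra_simps)
  moreover have "\<dots> * (base_change a b)\<^sup>T = mat_of_rows_list 4
      [[(b + 1)\<^sup>2 * a, b, -a, 0], [b + 1, 0, -1, 0], [0, 0, 0, 1], [0, 0, 0, 0]]"
    by (rule eq_matI, simp_all add: base_change_def mat_of_rows_list_def
        less_Suc_eq numeral_eq_Suc scalar_prod_def)
      (elim disjE; hypsubst_thin; simp add: algebra_simps)
  ultimately show ?thesis
    by (simp only: row_expansion_twist_matrix)
qed

text \<open>Adding \<open>s\<close> times the isotropic second basis vector to the first adds
  \<open>s * (b + (b + 1))\<close> to the corner entry.\<close>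

lemma S_move_shear: "S_move (twist_matrix a b) (twist_matrix (a + s * (2 * b + 1)) b)"
proof -
  let ?P = "mat_of_rows_list 2 [[1, s], [0, 1]] :: int mat"
  have "?P * twist_matrix a b * ?P\<^sup>T = twist_matrix (a + s * (2 * b + 1)) b"
    by (rule eq_matI)
      (auto simp: twist_matrix_def mat_of_rows_list_def less_Suc_eq numeral_eq_Suc
        scalar_prod_def algebra_simps)
  moreover have "S_move (twist_matrix a b) (?P * twist_matrix a b * ?P\<^sup>T)"
  proof (rule S_move.congruence[OF seifert_twist_matrix twist_matrix_carrier])
    show "?P \<in> carrier_mat 2 2"
      by (rule mat_of_rows_list_carrierI) simp
    show "\<bar>det ?P\<bar> = 1"
      by (simp add: mat_of_rows_list_def numeral_eq_Suc det_mat_Suc det_mat_0)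
  qed
  ultimately show ?thesis by simp
qed

lemma equivclp_scale: "equivclp S_move (twist_matrix a b) (twist_matrix ((b + 1)\<^sup>2 * a) b)"
proof -
  let ?R = "row_expansion (twist_matrix ((b + 1)\<^sup>2 * a) b) (vec_of_list [-a, -1])"
  have "S_move (twist_matrix a b) (twist_expansion a b)"
    unfolding column_expansion_twist_matrix[symmetric]
    by (rule S_move.column[OF seifert_twist_matrix])
      (simp add: twist_matrix_def mat_of_rows_list_def carrier_vecI)
  moreover have "S_move (twist_expansion a b) ?R"
    unfolding base_change_twist_expansion[symmetric]
    by (rule S_move.congruence[OF seifert_twist_expansion twist_expansion_carrier
          base_change_carrier det_base_change])
  ultimately have "equivclp S_move (twist_matrix a b) ?R"
    by (rule equivclp_trans[OF r_into_equivclp r_into_equivclp])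
  moreover have "S_move (twist_matrix ((b + 1)\<^sup>2 * a) b) ?R"
    by (rule S_move.row[OF seifert_twist_matrix])
      (simp add: twist_matrix_def mat_of_rows_list_def carrier_vecI)
  ultimately show ?thesis
    by (rule equivclp_trans[OF _ equivclp_sym[OF r_into_equivclp]])
qed

theorem proposition5p5:
  fixes b :: int
  assumes "b > 4"
    and "b mod 3 = 0 \<or> b mod 3 = 2"
  shows "\<exists>a :: int. S_equivalent
           (mat_of_rows_list 2 [[a, b], [b + 1, 0]])
           (mat_of_rows_list 2 [[a + 1, b], [b + 1, 0]])"
proof -
  define k where "k = b div 3"
  have "\<exists>a s. (b + 1)\<^sup>2 * a = (a + 1) + s * (2 * b + 1)"
    using assms(2)
  proof
    assume "b mod 3 = 0"
    then have b: "b = 3 * k" using k_def by presburger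
    \<comment> \<open>Here \<open>3 * a = (2 * b + 1) - 4\<close>; \<open>s\<close> is the resulting
      quotient.\<close>
    show ?thesis unfolding b
      by (rule exI[of _ "2 * k - 1"], rule exI[of _ "3 * k\<^sup>2 - 1"])
        (simp add: algebra_simps power2_eq_square)
  next
    assume "b mod 3 = 2"
    then have b: "b = 3 * k + 2" using k_def by presburger
    \<comment> \<open>Here \<open>3 * a = 2 * (2 * b + 1) - 4\<close>.\<close>
    show ?thesis unfolding b
      by (rule exI[of _ "4 * k + 2"], rule exI[of _ "6 * k\<^sup>2 + 10 * k + 3"])
        (simp add: algebra_simps power2_eq_square)
  qed
  then obtain a s where "(b + 1)\<^sup>2 * a = (a + 1) + s * (2 * b + 1)" by blast
  then have "S_move (twist_matrix (a + 1) b) (twist_matrix ((b + 1)\<^sup>2 * a) b)"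
    using S_move_shear[of "a + 1" b s] by simp
  then have "equivclp S_move (twist_matrix a b) (twist_matrix (a + 1) b)"
    by (rule equivclp_trans[OF equivclp_scale equivclp_sym[OF r_into_equivclp]])
  then have "S_equivalent (twist_matrix a b) (twist_matrix (a + 1) b)"
    by (simp add: S_equivalent_def seifert_twist_matrix)
  then show ?thesis
    unfolding twist_matrix_def by blast
qed

end
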